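(* Let $G$ be a countable amenable group with a F{\o}lner sequence $(F_n)$, and let $H$ be a nonnegative real function on $\mathcal F(G)$ which is $G$-invariant, i.e. $H(Fg)=H(F)$ for all $F\in\mathcal F(G)$ and $g\in G$. If $H$ satisfies Shearer's inequality, then $H$ satisfies the infimum rule, i.e. $$\limsup_{n\to\infty}\frac1{|F_n|}H(F_n)=\inf_{F\in\mathcal F(G)}\frac1{|F|}H(F).$$
   Context: $\mathcal F(G)$ denotes the collection of all nonempty finite subsets of $G$, and $|F|$ is the cardinality of $F$. A F{\o}lner sequence in $G$ is a sequence $(F_n)$ of nonempty finite subsets of $G$ such that $\lim_{n\to\infty}\frac{|F_n\triangle gF_n|}{|F_n|}=0$ for every $g\in G$. For an integer $k\ge 1$, a $k$-cover of $F\in\mathcal F(G)$ is a finite family $\mathcal K=\{K_1,\dots,K_r\}$ of elements of $\mathcal F(G)$, with possible repetitions, such that each element of $F$ belongs to $K_i$ for at least $k$ indices $i$. The function $H$ satisfies Shearer's inequality if for every $F\in\mathcal F(G)$, every $k\ge1$ and every $k$-cover $\mathcal K$ of $F$, $H(F)\le\frac1k\sum_{K\in\mathcal K}H(K)$, where the sum is over the indices $i$ (repeated terms are counted separately). *)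

theory Defs
  imports Complex_Main "HOL-Algebra.Coset" "HOL-Library.Countable_Set" "HOL-Library.Extended_Real"
begin

text \<open>The nonempty finite subsets of \<open>G\<close>, written \<open>\<F>(G)\<close> in the literature.\<close>

definition finite_subsets :: "('a, 'b) monoid_scheme \<Rightarrow> 'a set set" where
  "finite_subsets G = {F. F \<subseteq> carrier G \<and> finite F \<and> F \<noteq> {}}"

definition Folner_sequence :: "('a, 'b) monoid_scheme \<Rightarrow> (nat \<Rightarrow> 'a set) \<Rightarrow> bool" where
  "Folner_sequence G F \<longleftrightarrow>
     (\<forall>n. F n \<in> finite_subsets G) \<and>
     (\<forall>g\<in>carrier G.
        (\<lambda>n. real (card (sym_diff (F n) (g <#\<^bsub>G\<^esub> F n))) / real (card (F n))) \<longlonglongrightarrow> 0)"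

text \<open>Amenability in the Folner form, which is meant for countable groups only.\<close>

definition amenable :: "('a, 'b) monoid_scheme \<Rightarrow> bool" where
  "amenable G \<longleftrightarrow> (\<exists>F. Folner_sequence G F)"

definition right_invariant :: "('a, 'b) monoid_scheme \<Rightarrow> ('a set \<Rightarrow> real) \<Rightarrow> bool" where
  "right_invariant G H \<longleftrightarrow>
     (\<forall>F\<in>finite_subsets G. \<forall>g\<in>carrier G. H (F #>\<^bsub>G\<^esub> g) = H F)"

text \<open>A finite family with possible repetitions is a list; the membership count is over
  positions of the list, so repeated members are counted separately.\<close>

definition k_cover :: "('a, 'b) monoid_scheme \<Rightarrow> nat \<Rightarrow> 'a set \<Rightarrow> 'a set list \<Rightarrow> bool" where
  "k_cover G k F Ks \<longleftrightarrow>
     set Ks \<subseteq> finite_subsets G \<and>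
     (\<forall>x\<in>F. k \<le> card {i. i < length Ks \<and> x \<in> Ks ! i})"

definition Shearer_inequality :: "('a, 'b) monoid_scheme \<Rightarrow> ('a set \<Rightarrow> real) \<Rightarrow> bool" where
  "Shearer_inequality G H \<longleftrightarrow>
     (\<forall>F\<in>finite_subsets G. \<forall>k\<ge>1. \<forall>Ks. k_cover G k F Ks \<longrightarrow>
        H F \<le> (1 / real k) * (\<Sum>i<length Ks. H (Ks ! i)))"

end

theory Submission
  imports Defs
begin

text \<open>Fix \<open>A \<in> \<F>(G)\<close>. An element \<open>x\<close> lies in \<open>A g\<close> for exactly the \<open>|A|\<close> elements
  \<open>g \<in> A\<^sup>-\<^sup>1 x\<close>, so the right translates \<open>A g\<close> with \<open>g \<in> F\<^sub>n \<union> A\<^sup>-\<^sup>1 F\<^sub>n\<close> form an \<open>|A|\<close>-cover of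
  \<open>F\<^sub>n\<close>. Shearer's inequality and invariance give
  \<open>H(F\<^sub>n) / |F\<^sub>n| \<le> (|F\<^sub>n \<union> A\<^sup>-\<^sup>1 F\<^sub>n| / |F\<^sub>n|) (H(A) / |A|)\<close>, and the first factor tends to 1 by the
  Folner property.\<close>

lemma (in group) r_coset_mem_finite_subsets:
  assumes "A \<in> finite_subsets G" "g \<in> carrier G"
  shows "A #> g \<in> finite_subsets G"
  using assms by (auto simp: finite_subsets_def r_coset_def)

text \<open>For x in F the elements \<open>inv a \<otimes> x\<close> are |A| different members of
  \<open>set gs\<close>, and each of them moves A onto a set containing x. Further members of
  \<open>set gs\<close> do no harm, since a cover bounds multiplicities only from below.\<close>

lemma (in group) k_cover_right_translates:
  assumes A: "A \<in> finite_subsets G" and F: "F \<subseteq> carrier G"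
    and gs: "set gs \<subseteq> carrier G" "distinct gs"
    and sub: "(\<Union>a\<in>A. inv a <# F) \<subseteq> set gs"
  shows "k_cover G (card A) F (map (\<lambda>g. A #> g) gs)"
  unfolding k_cover_def
proof (intro conjI ballI)
  show "set (map (\<lambda>g. A #> g) gs) \<subseteq> finite_subsets G"
    using r_coset_mem_finite_subsets[OF A] gs(1) by auto
next
  fix x assume x: "x \<in> F"
  have A': "A \<subseteq> carrier G" "finite A" using A by (auto simp: finite_subsets_def)
  have x': "x \<in> carrier G" using x F by auto
  have inj: "inj_on (\<lambda>a. inv a \<otimes> x) A"
    using A'(1) x' by (intro inj_onI) (metis inv_closed inv_inv right_cancel subsetD)
  have img: "(\<lambda>a. inv a \<otimes> x) ` A \<subseteq> set (filter (\<lambda>g. x \<in> A #> g) gs)"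
  proof
    fix g assume "g \<in> (\<lambda>a. inv a \<otimes> x) ` A"
    then obtain a where a: "a \<in> A" "g = inv a \<otimes> x" by auto
    have "a \<otimes> g = x" using a A'(1) x' by (simp add: m_assoc[symmetric] subset_iff)
    then have "x \<in> A #> g" using a(1) by (auto simp: r_coset_def)
    moreover have "g \<in> set gs" using sub a x by (auto simp: l_coset_def)
    ultimately show "g \<in> set (filter (\<lambda>g. x \<in> A #> g) gs)" by simp
  qed
  \<comment> \<open>Passes from counting elements of \<open>gs\<close> to counting list positions,
    as \<open>k_cover\<close> requires.\<close>
  have "card A = card ((\<lambda>a. inv a \<otimes> x) ` A)" using inj by (simp add: card_image)
  also have "\<dots> \<le> card (set (filter (\<lambda>g. x \<in> A #> g) gs))"
    by (rule card_mono[OF _ img]) simp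
  also have "\<dots> = length (filter (\<lambda>g. x \<in> A #> g) gs)"
    using gs(2) by (intro distinct_card) simp
  also have "\<dots> = card {i. i < length gs \<and> x \<in> A #> (gs ! i)}"
    by (rule length_filter_conv_card)
  also have "{i. i < length gs \<and> x \<in> A #> (gs ! i)} =
      {i. i < length (map (\<lambda>g. A #> g) gs) \<and> x \<in> map (\<lambda>g. A #> g) gs ! i}"
    by auto
  finally show "card A \<le> card {i. i < length (map (\<lambda>g. A #> g) gs) \<and> x \<in> map (\<lambda>g. A #> g) gs ! i}" .
qed

text \<open>A point of \<open>T a\<close> outside F lies in \<open>sym_diff F (T a)\<close>. This
  brings in the quantities that the Folner condition controls.\<close>

lemma card_Un_UN_le_sum_sym_diff:
  assumes "finite F" "finite A" "\<And>a. a \<in> A \<Longrightarrow> finite (T a)"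
  shows "card (F \<union> (\<Union>a\<in>A. T a)) \<le> card F + (\<Sum>a\<in>A. card (sym_diff F (T a)))"
proof -
  have "card (F \<union> (\<Union>a\<in>A. T a)) \<le> card (F \<union> (\<Union>a\<in>A. sym_diff F (T a)))"
    using assms by (intro card_mono) auto
  also have "\<dots> \<le> card F + card (\<Union>a\<in>A. sym_diff F (T a))"
    by (rule card_Un_le)
  also have "\<dots> \<le> card F + (\<Sum>a\<in>A. card (sym_diff F (T a)))"
    using assms(2) by (intro add_left_mono card_UN_le)
  finally show ?thesis .
qed

text \<open>The estimate for a single F, with an explicit error. Solving x = a g for g multiplies F
  on the left, so the error consists of left translates as in the Folner condition, while A is moved
  on the right, where H is invariant.\<close>

lemma (in group) Shearer_mean_le:
  assumes F: "F \<in> finite_subsets G" and A: "A \<in> finite_subsets G"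
    and nonneg: "0 \<le> H A"
    and inv: "right_invariant G H" and Sh: "Shearer_inequality G H"
  shows "1 / real (card F) * H F \<le>
    (1 + (\<Sum>a\<in>A. real (card (sym_diff F (inv a <# F))) / real (card F))) * (1 / real (card A) * H A)"
proof -
  have F': "F \<subseteq> carrier G" "finite F" "F \<noteq> {}" and A': "A \<subseteq> carrier G" "finite A" "A \<noteq> {}"
    using F A by (auto simp: finite_subsets_def)
  have pos: "card F > 0" "card A > 0" using F' A' by (auto simp: card_gt_0_iff)
  define S where "S = F \<union> (\<Union>a\<in>A. inv a <# F)"
  have finT: "finite (inv a <# F)" for a using F'(2) by (simp add: l_coset_def)
  have "finite S" using F' A' finT by (simp add: S_def)
  \<comment> \<open>Listing S without repetition gives the family exactly |S| members.\<close>
  then obtain gs where gs: "set gs = S" "distinct gs"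
    using finite_distinct_list by blast
  have Sc: "S \<subseteq> carrier G" using F'(1) A'(1) by (auto simp: S_def l_coset_def)
  have HS: "H (A #> g) = H A" if "g \<in> S" for g
    using inv A that Sc by (auto simp: right_invariant_def)
  have "k_cover G (card A) F (map (\<lambda>g. A #> g) gs)"
    by (rule k_cover_right_translates[OF A F'(1)]) (use gs Sc in \<open>auto simp: S_def\<close>)
  \<comment> \<open>Shearer's inequality with k = |A|, which is at least 1 because A is
    nonempty.\<close>
  then have "H F \<le> 1 / real (card A) *
      (\<Sum>i<length (map (\<lambda>g. A #> g) gs). H (map (\<lambda>g. A #> g) gs ! i))"
    using Sh F pos(2) unfolding Shearer_inequality_def by (metis One_nat_def Suc_leI)
  also have "(\<Sum>i<length (map (\<lambda>g. A #> g) gs). H (map (\<lambda>g. A #> g) gs ! i)) =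
      (\<Sum>i<length gs. H A)"
    using HS gs(1) by (intro sum.cong) auto
  also have "\<dots> = real (card S) * H A"
    using gs distinct_card by fastforce
  finally have "H F \<le> real (card S) * (1 / real (card A) * H A)" by simp
  \<comment> \<open>Enlarging the factor |S| preserves the bound because H A is nonnegative.\<close>
  also have "\<dots> \<le> real (card F + (\<Sum>a\<in>A. card (sym_diff F (inv a <# F)))) *
      (1 / real (card A) * H A)"
    using card_Un_UN_le_sum_sym_diff[OF F'(2) A'(2) finT] nonneg
    unfolding S_def by (intro mult_right_mono of_nat_mono) auto
  finally have "1 / real (card F) * H F \<le> 1 / real (card F) *
      (real (card F + (\<Sum>a\<in>A. card (sym_diff F (inv a <# F)))) * (1 / real (card A) * H A))"
    by (intro mult_left_mono) auto
  also have "\<dots> = (1 + (\<Sum>a\<in>A. real (card (sym_diff F (inv a <# F))) / real (card F))) *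
      (1 / real (card A) * H A)"
    using pos by (simp add: sum_divide_distrib[symmetric] field_simps)
  finally show ?thesis .
qed

theorem proposition3p3:
  fixes G :: "('a, 'b) monoid_scheme"
    and F :: "nat \<Rightarrow> 'a set"
    and H :: "'a set \<Rightarrow> real"
  assumes "group G"
    and "countable (carrier G)"
    and "amenable G"
    and "Folner_sequence G F"
    and "\<And>A. A \<in> finite_subsets G \<Longrightarrow> 0 \<le> H A"
    and "right_invariant G H"
    and "Shearer_inequality G H"
  shows "limsup (\<lambda>n. ereal ((1 / real (card (F n))) * H (F n)))
       = (INF A\<in>finite_subsets G. ereal ((1 / real (card A)) * H A))"
proof (rule antisym)
  interpret group G by fact
  have F: "F n \<in> finite_subsets G" for n
    using assms(4) by (simp add: Folner_sequence_def)
  show "limsup (\<lambda>n. ereal ((1 / real (card (F n))) * H (F n)))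
      \<le> (INF A\<in>finite_subsets G. ereal ((1 / real (card A)) * H A))"
  proof (rule INF_greatest)
    fix A assume A: "A \<in> finite_subsets G"
    define b where "b n = (1 + (\<Sum>a\<in>A. real (card (sym_diff (F n) (inv\<^bsub>G\<^esub> a <#\<^bsub>G\<^esub> F n))) / real (card (F n))))
      * (1 / real (card A) * H A)" for n
    \<comment> \<open>A is fixed and finite, so the error is a finite sum of null sequences. The
      limit is left unsimplified to mirror the shape of \<open>b\<close>.\<close>
    have "b \<longlonglongrightarrow> (1 + (\<Sum>a\<in>A. 0)) * (1 / real (card A) * H A)"
      unfolding b_def
    proof (intro tendsto_intros)
      fix a assume "a \<in> A"
      then have "inv\<^bsub>G\<^esub> a \<in> carrier G" using A by (auto simp: finite_subsets_def)
      then show "(\<lambda>n. real (card (sym_diff (F n) (inv\<^bsub>G\<^esub> a <#\<^bsub>G\<^esub> F n))) / real (card (F n))) \<longlonglongrightarrow> 0"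
        using assms(4) unfolding Folner_sequence_def by blast
    qed
    then have "(\<lambda>n. ereal (b n)) \<longlonglongrightarrow> ereal (1 / real (card A) * H A)" by simp
    then have "limsup (\<lambda>n. ereal (b n)) = ereal (1 / real (card A) * H A)"
      by (intro lim_imp_Limsup) auto
    moreover have "limsup (\<lambda>n. ereal ((1 / real (card (F n))) * H (F n))) \<le> limsup (\<lambda>n. ereal (b n))"
      unfolding b_def
      by (intro Limsup_mono always_eventually allI)
        (use Shearer_mean_le[OF F A assms(5)[OF A] assms(6,7)] in \<open>simp only: ereal_less_eq\<close>)
    ultimately show "limsup (\<lambda>n. ereal ((1 / real (card (F n))) * H (F n)))
        \<le> ereal ((1 / real (card A)) * H A)" by simp
  qed
  \<comment> \<open>Each \<open>F n\<close> competes in the infimum, so every term of the sequence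
    is already at least the infimum.\<close>
  show "(INF A\<in>finite_subsets G. ereal ((1 / real (card A)) * H A))
      \<le> limsup (\<lambda>n. ereal ((1 / real (card (F n))) * H (F n)))"
    by (intro le_Limsup always_eventually allI INF_lower F) simp
qed

end
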